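(* Let $g>0$, $H>0$ and $U\in\mathbb{R}$ be constants, and consider the initial boundary value problem for $\mathbf{q}=[h,u]^\top$, $$\frac{\partial \mathbf{q}}{\partial t}=-M\frac{\partial \mathbf{q}}{\partial x}\ \ (x\in[0,1],\ t\ge 0),\qquad \mathbf{q}(x,0)=\mathbf{f}(x)\ \ (x\in[0,1]),\qquad M=\begin{bmatrix}U&H\\ g&U\end{bmatrix},$$ with $\mathbf{f}\in L^2([0,1])$, and with the following homogeneous boundary conditions for $t\ge 0$, where $w_1,w_2,\lambda_1,\lambda_2$ are as defined in the context: - Sub-critical flow, $U^2<gH$: $w_1-\gamma_0 w_2=0$ at $x=0$ and $w_2-\gamma_1 w_1=0$ at $x=1$, where $\gamma_0,\gamma_1\in\mathbb{R}$ satisfy $\gamma_0^2\le -\lambda_2/\lambda_1$ and $\gamma_1^2\le-\lambda_1/\lambda_2$. - Super-critical flow, $U^2>gH$: $w_1=0$ and $w_2=0$ at $x=0$ if $U>0$; $w_1=0$ and $w_2=0$ at $x=1$ if $U<0$. - Critical flow, $U^2=gH$: $w_1=0$ at $x=0$ if $U>0$ (where $\lambda_2=0$); $w_2=0$ at $x=1$ if $U<0$ (where $\lambda_1=0$). Then we have the energy estimate $$\frac12\frac{d}{dt}\Vert\mathbf{q}\Vert_W^2=gH\times \mathrm{BT}\le 0.$$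
   Context: The weight matrix is $W=\begin{bmatrix}g&0\\0&H\end{bmatrix}$ and $\Vert\mathbf{q}\Vert_W^2=\int_0^1\mathbf{q}^\top W\mathbf{q}\,dx$. Put $\widetilde M=WM$ (a symmetric matrix). The boundary term is $$\mathrm{BT}=-\frac{1}{2gH}\left(\mathbf{q}^\top\widetilde M\mathbf{q}\right)\Big|_{x=0}^{x=1}=\frac12\left(\lambda_1w_1^2+\lambda_2w_2^2\right)\Big|_{x=0}-\frac12\left(\lambda_1w_1^2+\lambda_2w_2^2\right)\Big|_{x=1}.$$ Here $\lambda_1,\lambda_2$ are the eigenvalues of $\frac{1}{gH}\widetilde M$, $$\lambda_{1}=\frac{1}{2gH}\left(U(g+H)+\sqrt{U^2(g+H)^2+4gH(gH-U^2)}\right),$$ $$\lambda_{2}=\frac{1}{2gH}\left(U(g+H)-\sqrt{U^2(g+H)^2+4gH(gH-U^2)}\right),$$ and $[w_1,w_2]^\top=S^\top\mathbf{q}$ with the orthogonal matrix $$S=\begin{bmatrix}\frac1c\left(\lambda_1-\frac Ug\right)&\frac1d\left(\lambda_2-\frac Ug\right)\\ \frac1c&\frac1d\end{bmatrix},\quad c=\sqrt{\left(\lambda_1-\tfrac Ug\right)^2+1},\quad d=\sqrt{\left(\lambda_2-\tfrac Ug\right)^2+1}.$$ In the sub-critical case $\lambda_1>0$ and $\lambda_2<0$; in the super-critical case both eigenvalues have the sign of $U$; in the critical case $\lambda_1>0,\lambda_2=0$ if $U>0$ and $\lambda_1=0,\lambda_2<0$ if $U<0$. *)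

theory Defs
  imports "HOL-Analysis.Analysis"
begin

text \<open>A state \<open>q :: real ^ 2\<close> is \<open>[h, u]\<close>, and a field \<open>q x t\<close> takes the space variable first.\<close>

definition flux_matrix :: "real \<Rightarrow> real \<Rightarrow> real \<Rightarrow> real ^ 2 ^ 2" where
  "flux_matrix g H U = vector [vector [U, H], vector [g, U]]"

definition weight_matrix :: "real \<Rightarrow> real \<Rightarrow> real ^ 2 ^ 2" where
  "weight_matrix g H = vector [vector [g, 0], vector [0, H]]"

definition sym_matrix :: "real \<Rightarrow> real \<Rightarrow> real \<Rightarrow> real ^ 2 ^ 2" where
  "sym_matrix g H U = weight_matrix g H ** flux_matrix g H U"

definition lambda1 :: "real \<Rightarrow> real \<Rightarrow> real \<Rightarrow> real" where
  "lambda1 g H U =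
     1 / (2 * g * H) * (U * (g + H) + sqrt (U\<^sup>2 * (g + H)\<^sup>2 + 4 * g * H * (g * H - U\<^sup>2)))"

definition lambda2 :: "real \<Rightarrow> real \<Rightarrow> real \<Rightarrow> real" where
  "lambda2 g H U =
     1 / (2 * g * H) * (U * (g + H) - sqrt (U\<^sup>2 * (g + H)\<^sup>2 + 4 * g * H * (g * H - U\<^sup>2)))"

definition S_matrix :: "real \<Rightarrow> real \<Rightarrow> real \<Rightarrow> real ^ 2 ^ 2" where
  "S_matrix g H U =
     (let a = lambda1 g H U - U / g; b = lambda2 g H U - U / g;
          c = sqrt (a\<^sup>2 + 1); d = sqrt (b\<^sup>2 + 1)
      in vector [vector [1 / c * a, 1 / d * b], vector [1 / c, 1 / d]])"

definition w1 :: "real \<Rightarrow> real \<Rightarrow> real \<Rightarrow> real ^ 2 \<Rightarrow> real" where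
  "w1 g H U v = (transpose (S_matrix g H U) *v v) $ 1"

definition w2 :: "real \<Rightarrow> real \<Rightarrow> real \<Rightarrow> real ^ 2 \<Rightarrow> real" where
  "w2 g H U v = (transpose (S_matrix g H U) *v v) $ 2"

definition BT :: "real \<Rightarrow> real \<Rightarrow> real \<Rightarrow> (real \<Rightarrow> real ^ 2) \<Rightarrow> real" where
  "BT g H U p = - (1 / (2 * g * H)) *
     (p 1 \<bullet> (sym_matrix g H U *v p 1) - p 0 \<bullet> (sym_matrix g H U *v p 0))"

definition W_norm :: "real \<Rightarrow> real \<Rightarrow> (real \<Rightarrow> real ^ 2) \<Rightarrow> real" where
  "W_norm g H p = sqrt (LINT x | lebesgue_on {0..1}. p x \<bullet> (weight_matrix g H *v p x))"

definition L2_on :: "real set \<Rightarrow> (real \<Rightarrow> real ^ 2) \<Rightarrow> bool" where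
  "L2_on S p \<longleftrightarrow> p \<in> borel_measurable (lebesgue_on S) \<and>
     integrable (lebesgue_on S) (\<lambda>x. (norm (p x))\<^sup>2)"

definition L2_tendsto :: "real set \<Rightarrow> (nat \<Rightarrow> real \<Rightarrow> real ^ 2) \<Rightarrow> (real \<Rightarrow> real ^ 2) \<Rightarrow> bool" where
  "L2_tendsto S P p \<longleftrightarrow> (\<forall>n. L2_on S (P n)) \<and> L2_on S p \<and>
     (\<lambda>n. LINT x | lebesgue_on S. (norm (P n x - p x))\<^sup>2) \<longlonglongrightarrow> 0"

text \<open>Pointwise solutions of the system that are \<open>C\<^sup>1\<close> on \<open>[0,1] \<times> [0,\<infinity>)\<close>; the derivatives are
  one-sided at the boundary.\<close>

definition classical_pde :: "real \<Rightarrow> real \<Rightarrow> real \<Rightarrow> (real \<Rightarrow> real \<Rightarrow> real ^ 2) \<Rightarrow> bool" where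
  "classical_pde g H U q \<longleftrightarrow>
     (\<exists>qt qx :: real \<Rightarrow> real \<Rightarrow> real ^ 2.
        continuous_on ({0..1} \<times> {0..}) (\<lambda>(x, t). qt x t) \<and>
        continuous_on ({0..1} \<times> {0..}) (\<lambda>(x, t). qx x t) \<and>
        (\<forall>x\<in>{0..1}. \<forall>t\<ge>0.
           ((\<lambda>s. q x s) has_vector_derivative qt x t) (at t within {0..}) \<and>
           ((\<lambda>y. q y t) has_vector_derivative qx x t) (at x within {0..1}) \<and>
           qt x t = - (flux_matrix g H U *v qx x t)))"

definition boundary_conditions ::
    "real \<Rightarrow> real \<Rightarrow> real \<Rightarrow> real \<Rightarrow> real \<Rightarrow> (real \<Rightarrow> real ^ 2) \<Rightarrow> bool" where
  "boundary_conditions g H U \<gamma>0 \<gamma>1 p \<longleftrightarrow>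
     (U\<^sup>2 < g * H \<longrightarrow>
        w1 g H U (p 0) - \<gamma>0 * w2 g H U (p 0) = 0 \<and>
        w2 g H U (p 1) - \<gamma>1 * w1 g H U (p 1) = 0) \<and>
     (U\<^sup>2 > g * H \<longrightarrow>
        (U > 0 \<longrightarrow> w1 g H U (p 0) = 0 \<and> w2 g H U (p 0) = 0) \<and>
        (U < 0 \<longrightarrow> w1 g H U (p 1) = 0 \<and> w2 g H U (p 1) = 0)) \<and>
     (U\<^sup>2 = g * H \<longrightarrow>
        (U > 0 \<longrightarrow> w1 g H U (p 0) = 0) \<and>
        (U < 0 \<longrightarrow> w2 g H U (p 1) = 0))"

definition classical_solution ::
    "real \<Rightarrow> real \<Rightarrow> real \<Rightarrow> real \<Rightarrow> real \<Rightarrow> (real \<Rightarrow> real ^ 2) \<Rightarrow> (real \<Rightarrow> real \<Rightarrow> real ^ 2) \<Rightarrow> bool" where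
  "classical_solution g H U \<gamma>0 \<gamma>1 f q \<longleftrightarrow>
     classical_pde g H U q \<and>
     (\<forall>x\<in>{0..1}. q x 0 = f x) \<and>
     (\<forall>t\<ge>0. boundary_conditions g H U \<gamma>0 \<gamma>1 (\<lambda>x. q x t))"

text \<open>A general initial datum in \<open>L\<^sup>2\<close> has no \<open>C\<^sup>1\<close> solution.  The corresponding generalized (strong)
  solutions are the limits of classical solutions of the same initial boundary value problem, in
  \<open>L\<^sup>2([0,1])\<close> at each time, with boundary values converging in \<open>L\<^sup>2([0,T])\<close> for each \<open>T\<close>.  As
  \<open>q x t\<close> is only determined up to null sets in \<open>x\<close>, the values \<open>q 0 t\<close> and \<open>q 1 t\<close> are free to carry
  the boundary traces; these satisfy the boundary conditions for almost every \<open>t\<close>, since those are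
  linear.\<close>

definition generalized_solution ::
    "real \<Rightarrow> real \<Rightarrow> real \<Rightarrow> real \<Rightarrow> real \<Rightarrow> (real \<Rightarrow> real ^ 2) \<Rightarrow> (real \<Rightarrow> real \<Rightarrow> real ^ 2) \<Rightarrow> bool" where
  "generalized_solution g H U \<gamma>0 \<gamma>1 f q \<longleftrightarrow>
     (AE x in lebesgue_on {0..1}. q x 0 = f x) \<and>
     (\<exists>Q :: nat \<Rightarrow> real \<Rightarrow> real \<Rightarrow> real ^ 2.
        (\<forall>n. classical_solution g H U \<gamma>0 \<gamma>1 (\<lambda>x. Q n x 0) (Q n)) \<and>
        (\<forall>t\<ge>0. L2_tendsto {0..1} (\<lambda>n x. Q n x t) (\<lambda>x. q x t)) \<and>
        (\<forall>T>0. L2_tendsto {0..T} (\<lambda>n t. Q n 0 t) (\<lambda>t. q 0 t) \<and>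
               L2_tendsto {0..T} (\<lambda>n t. Q n 1 t) (\<lambda>t. q 1 t)))"

text \<open>The two expressions for the boundary term agree.\<close>

lemma sym_matrix_quadratic_form:
  assumes "g > 0" "H > 0"
  shows "v \<bullet> (sym_matrix g H U *v v) =
    g * H * (lambda1 g H U * (w1 g H U v)\<^sup>2 + lambda2 g H U * (w2 g H U v)\<^sup>2)"
proof -
  define R where "R = sqrt (U\<^sup>2 * (g + H)\<^sup>2 + 4 * g * H * (g * H - U\<^sup>2))"
  define a where "a = lambda1 g H U - U / g"
  define b where "b = lambda2 g H U - U / g"
  define x where "x = v $ 1"
  define y where "y = v $ 2"
  have "U\<^sup>2 * (g + H)\<^sup>2 + 4 * g * H * (g * H - U\<^sup>2) = U\<^sup>2 * (g - H)\<^sup>2 + (2 * g * H)\<^sup>2"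
    by (simp add: power2_eq_square algebra_simps)
  hence R2: "R\<^sup>2 = U\<^sup>2 * (g - H)\<^sup>2 + (2 * g * H)\<^sup>2"
    unfolding R_def by simp
  have a: "a = (U * (g - H) + R) / (2 * g * H)" and b: "b = (U * (g - H) - R) / (2 * g * H)"
    using assms by (simp_all add: a_def b_def lambda1_def lambda2_def R_def field_simps)
  have "a * b = ((U * (g - H))\<^sup>2 - R\<^sup>2) / (2 * g * H)\<^sup>2"
    by (simp add: a b power2_eq_square algebra_simps)
  hence ab: "a * b = - 1"
    using assms by (simp add: R2 power_mult_distrib)
  hence a0: "a \<noteq> 0"
    by auto
  have b': "b = - 1 / a"
    using ab nonzero_mult_div_cancel_left[OF a0, of b] by simp
  have sum: "a + b = U / H - U / g"
    using assms by (simp add: a b field_simps)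
  have pos: "0 < a\<^sup>2 + 1" "0 < b\<^sup>2 + 1"
    by (simp_all add: add_nonneg_pos)
  have w1: "w1 g H U v = (a * x + y) / sqrt (a\<^sup>2 + 1)"
    and w2: "w2 g H U v = (b * x + y) / sqrt (b\<^sup>2 + 1)"
    unfolding w1_def w2_def S_matrix_def Let_def a_def[symmetric] b_def[symmetric] x_def y_def
    by (simp_all add: matrix_vector_mult_def transpose_def sum_2 add_divide_distrib)
  have w1s: "(w1 g H U v)\<^sup>2 = (a * x + y)\<^sup>2 / (a\<^sup>2 + 1)"
    unfolding w1 power_divide using pos by simp
  have "(w2 g H U v)\<^sup>2 = (b * x + y)\<^sup>2 / (b\<^sup>2 + 1)"
    unfolding w2 power_divide using pos by simp
  also have "\<dots> = (a\<^sup>2 * (b * x + y)\<^sup>2) / (a\<^sup>2 * (b\<^sup>2 + 1))"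
    using a0 by simp
  also have "a\<^sup>2 * (b * x + y)\<^sup>2 = (a * b * x + a * y)\<^sup>2"
    by (simp add: power2_eq_square algebra_simps)
  also have "\<dots> = (a * y - x)\<^sup>2"
    by (simp add: ab)
  also have "a\<^sup>2 * (b\<^sup>2 + 1) = a\<^sup>2 + 1"
    using a0 by (simp add: b' field_simps)
  finally have w2s: "(w2 g H U v)\<^sup>2 = (a * y - x)\<^sup>2 / (a\<^sup>2 + 1)" .
  have l1: "lambda1 g H U = U / g + a" and l2: "lambda2 g H U = U / g - 1 / a"
    using b' by (simp_all add: a_def b_def)
  have UH: "U / H = U / g + a - 1 / a"
    using sum b' by simp
  have "lambda1 g H U * (w1 g H U v)\<^sup>2 + lambda2 g H U * (w2 g H U v)\<^sup>2 =
    ((U / g + a) * (a * x + y)\<^sup>2 + (U / g - 1 / a) * (a * y - x)\<^sup>2) / (a\<^sup>2 + 1)"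
    unfolding w1s w2s l1 l2 by (simp add: add_divide_distrib)
  also have "(U / g + a) * (a * x + y)\<^sup>2 + (U / g - 1 / a) * (a * y - x)\<^sup>2 =
    (a\<^sup>2 + 1) * (U / H * x\<^sup>2 + 2 * x * y + U / g * y\<^sup>2)"
    unfolding UH using a0 assms by (simp add: field_simps power2_eq_square)
  also have "\<dots> / (a\<^sup>2 + 1) = U / H * x\<^sup>2 + 2 * x * y + U / g * y\<^sup>2"
    using pos by simp
  finally have "lambda1 g H U * (w1 g H U v)\<^sup>2 + lambda2 g H U * (w2 g H U v)\<^sup>2 =
    U / H * x\<^sup>2 + 2 * x * y + U / g * y\<^sup>2" .
  moreover have "v \<bullet> (sym_matrix g H U *v v) = g * U * x\<^sup>2 + 2 * g * H * x * y + H * U * y\<^sup>2"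
    unfolding sym_matrix_def weight_matrix_def flux_matrix_def x_def y_def
    by (simp add: inner_vec_def matrix_vector_mult_def matrix_matrix_mult_def sum_2
        power2_eq_square algebra_simps)
  ultimately show ?thesis
    using assms by (simp add: field_simps)
qed

lemma BT_characteristic:
  assumes "g > 0" "H > 0"
  shows "BT g H U p =
    1 / 2 * (lambda1 g H U * (w1 g H U (p 0))\<^sup>2 + lambda2 g H U * (w2 g H U (p 0))\<^sup>2) -
    1 / 2 * (lambda1 g H U * (w1 g H U (p 1))\<^sup>2 + lambda2 g H U * (w2 g H U (p 1))\<^sup>2)"
  unfolding BT_def sym_matrix_quadratic_form[OF assms] using assms by (simp add: field_simps)

end

theory Submission
  imports Defs
begin

text \<open>For a \<open>C\<^sup>1\<close> solution, differentiating under the integral gives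
  \<open>d/dt (1/2 \<integral> q \<bullet> W q) = - \<integral> q \<bullet> W M \<partial>\<^sub>x q\<close>, and since \<open>W M\<close> is symmetric the integrand is the
  \<open>x\<close>-derivative of \<open>1/2 q \<bullet> W M q\<close>.  The sign of the boundary term comes from
  \<open>\<lambda>\<^sub>1 \<lambda>\<^sub>2 = (U\<^sup>2 - g H) / (g H)\<close> and \<open>\<lambda>\<^sub>1 + \<lambda>\<^sub>2 = U (g + H) / (g H)\<close>.

  The time-integrated identity and the monotonicity of the energy pass to \<open>L\<^sup>2\<close> limits, because both
  the energy and the integrated boundary term are quadratic forms.  Lebesgue differentiation then
  returns the identity at almost every time, and the derivative of a nonincreasing energy is
  nonpositive, so no boundary condition has to be passed to the limit.\<close>


section \<open>Lebesgue differentiation on the real line\<close>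

text \<open>The library's differentiability result is one-sided, hence the detour through the reflection
  \<open>f (- x)\<close>.\<close>

lemma has_vector_derivative_indefinite_integral_ae:
  fixes f :: "real \<Rightarrow> 'b::euclidean_space"
  assumes int: "\<And>a b. f integrable_on {a..b}"
  shows "\<exists>N. negligible N \<and> (\<forall>x a. x \<notin> N \<longrightarrow> a < x \<longrightarrow>
    ((\<lambda>s. integral {a..s} f) has_vector_derivative f x) (at x))"
proof -
  obtain N where N: "negligible N"
    and right: "\<And>x e. \<lbrakk>x \<notin> N; 0 < e\<rbrakk> \<Longrightarrow>
      \<exists>d>0. \<forall>h. 0 < h \<and> h < d \<longrightarrow> norm (integral {x..x + h} f /\<^sub>R h - f x) < e"
    using integrable_ccontinuous_explicit[where f = f] int by auto
  have "(\<lambda>x. f (- x)) integrable_on {a..b}" for a b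
    using Henstock_Kurzweil_Integration.integrable_reflect_real[of f "- a" "- b"] int by simp
  then obtain N' where N': "negligible N'"
    and left: "\<And>x e. \<lbrakk>x \<notin> N'; 0 < e\<rbrakk> \<Longrightarrow>
      \<exists>d>0. \<forall>h. 0 < h \<and> h < d \<longrightarrow>
        norm (integral {x..x + h} (\<lambda>x. f (- x)) /\<^sub>R h - f (- x)) < e"
    using integrable_ccontinuous_explicit[where f = "\<lambda>x. f (- x)"] by auto
  \<comment> \<open>The reflection is Lipschitz with constant 1, so it maps the exceptional set of
    the reflected function to a null set.\<close>
  have "negligible (uminus ` N')"
    by (rule negligible_locally_Lipschitz_image[OF _ N'])
      (auto intro!: exI[of _ "UNIV :: real set"] exI[of _ "1 :: real"]
        simp del: real_norm_def simp: norm_minus_commute)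
  hence "negligible (N \<union> uminus ` N')"
    using N by simp
  moreover have "((\<lambda>s. integral {a..s} f) has_vector_derivative f x) (at x)"
    if x: "x \<notin> N \<union> uminus ` N'" and ax: "a < x" for x a
    unfolding has_vector_derivative_def has_derivative_at_alt
  proof (intro conjI allI impI)
    show "bounded_linear (\<lambda>h. h *\<^sub>R f x)"
      by (rule bounded_linear_scaleR_left)
    fix e :: real
    assume e: "e > 0"
    have "- x \<notin> N'"
      using x by force
    obtain d1 where d1: "d1 > 0"
      "\<And>h. 0 < h \<Longrightarrow> h < d1 \<Longrightarrow> norm (integral {x..x + h} f /\<^sub>R h - f x) < e"
      using right[of x e] x e by auto
    obtain d2 where d2: "d2 > 0"
      "\<And>h. 0 < h \<Longrightarrow> h < d2 \<Longrightarrow>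
        norm (integral {- x..- x + h} (\<lambda>x. f (- x)) /\<^sub>R h - f x) < e"
      using left[OF \<open>- x \<notin> N'\<close> e] by auto
    have scale: "norm (I - h *\<^sub>R f x) \<le> e * h" if "h > 0" "norm (I /\<^sub>R h - f x) < e" for I h
    proof -
      have "I - h *\<^sub>R f x = h *\<^sub>R (I /\<^sub>R h - f x)"
        using that by (simp add: algebra_simps)
      thus ?thesis
        using that by (simp only: norm_scaleR) (simp add: mult.commute)
    qed
    \<comment> \<open>The entry \<open>x - a\<close> in the minimum keeps \<open>y\<close> to the
      right of the base point \<open>a\<close>, so that the integral from \<open>a\<close> can be
      split at \<open>y\<close> or at \<open>x\<close>.\<close>
    have "norm (integral {a..y} f - integral {a..x} f - (y - x) *\<^sub>R f x) \<le> e * norm (y - x)"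
      if y: "norm (y - x) < min (min d1 d2) (x - a)" for y
    proof (cases y x rule: linorder_cases)
      case less
      have ay: "a \<le> y"
        using y by auto
      \<comment> \<open>An increment to the left of \<open>x\<close> is an increment to the right of
        \<open>- x\<close> for the reflected function.\<close>
      have "integral {- x..- x + (x - y)} (\<lambda>x. f (- x)) = integral {y..x} f"
        using Henstock_Kurzweil_Integration.integral_reflect_real[of x y f] by simp
      hence "norm (integral {y..x} f - (x - y) *\<^sub>R f x) \<le> e * (x - y)"
        using scale[of "x - y" "integral {y..x} f"] d2(2)[of "x - y"] less y by auto
      moreover have "integral {a..y} f + integral {y..x} f = integral {a..x} f"
        using Henstock_Kurzweil_Integration.integral_combine[of a y x f] ay less int by simp
      hence "integral {a..y} f - integral {a..x} f - (y - x) *\<^sub>R f x =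
          - (integral {y..x} f - (x - y) *\<^sub>R f x)"
        by (simp add: algebra_simps)
      ultimately show ?thesis
        using less by (simp only: norm_minus_cancel) simp
    next
      case equal
      thus ?thesis by simp
    next
      case greater
      have "norm (integral {x..y} f - (y - x) *\<^sub>R f x) \<le> e * (y - x)"
        using scale[of "y - x" "integral {x..y} f"] d1(2)[of "y - x"] greater y by auto
      moreover have "integral {a..x} f + integral {x..y} f = integral {a..y} f"
        using Henstock_Kurzweil_Integration.integral_combine[of a x y f] ax greater int by simp
      hence "integral {a..y} f - integral {a..x} f - (y - x) *\<^sub>R f x =
          integral {x..y} f - (y - x) *\<^sub>R f x"
        by (simp add: algebra_simps)
      ultimately show ?thesis
        using greater by simp
    qed
    thus "\<exists>d>0. \<forall>y. norm (y - x) < d \<longrightarrow>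
        norm (integral {a..y} f - integral {a..x} f - (y - x) *\<^sub>R f x) \<le> e * norm (y - x)"
      using d1(1) d2(1) ax by (intro exI[of _ "min (min d1 d2) (x - a)"]) auto
  qed
  ultimately show ?thesis
    by blast
qed

section \<open>Quadratic forms: derivatives and limits in the mean\<close>

lemma bilinear_form_bound:
  fixes A :: "real ^ 'n ^ 'n"
  shows "\<exists>K\<ge>0. \<forall>u v. \<bar>u \<bullet> (A *v v)\<bar> \<le> K * norm u * norm v"
proof (intro exI[of _ "onorm ((*v) A)"] conjI allI)
  fix u v :: "real ^ 'n"
  have "\<bar>u \<bullet> (A *v v)\<bar> \<le> norm u * norm (A *v v)"
    by (rule Cauchy_Schwarz_ineq2)
  also have "\<dots> \<le> norm u * (onorm ((*v) A) * norm v)"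
    by (intro mult_left_mono onorm matrix_vector_mul_bounded_linear norm_ge_zero)
  finally show "\<bar>u \<bullet> (A *v v)\<bar> \<le> onorm ((*v) A) * norm u * norm v"
    by (simp add: mult_ac)
qed (simp add: onorm_pos_le)

lemma continuous_on_matrix_vector_mult [continuous_intros]:
  fixes A :: "real ^ 'n ^ 'm"
  assumes "continuous_on S p"
  shows "continuous_on S (\<lambda>x. A *v p x)"
  using bounded_linear.continuous_on[OF matrix_vector_mul_bounded_linear assms] .

text \<open>The product rule yields two terms, which symmetry of \<open>A\<close> makes equal. It
  serves twice: with \<open>W\<close> in time and with \<open>W M\<close> in space.\<close>

lemma quadratic_form_has_derivative:
  fixes A :: "real ^ 'n ^ 'n"
  assumes sym: "transpose A = A"
    and p: "(p has_vector_derivative p') (at t within S)"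
  shows "((\<lambda>s. p s \<bullet> (A *v p s)) has_real_derivative 2 * (p t \<bullet> (A *v p'))) (at t within S)"
proof -
  have "((\<lambda>s. A *v p s) has_vector_derivative A *v p') (at t within S)"
    using bounded_linear.has_vector_derivative[OF matrix_vector_mul_bounded_linear p] .
  from bounded_bilinear.has_vector_derivative[OF bounded_bilinear_inner p this]
  have "((\<lambda>s. p s \<bullet> (A *v p s)) has_vector_derivative p t \<bullet> (A *v p') + p' \<bullet> (A *v p t)) (at t within S)" .
  moreover have "p' \<bullet> (A *v p t) = p t \<bullet> (A *v p')"
    using sym by (metis dot_lmul_matrix inner_commute transpose_matrix_vector)
  ultimately show ?thesis
    by (simp add: has_real_derivative_iff_has_vector_derivative)
qed

lemma L2_on_quadratic_form_integrable:
  fixes A :: "real ^ 2 ^ 2"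
  assumes p: "L2_on S p"
  shows "integrable (lebesgue_on S) (\<lambda>x. p x \<bullet> (A *v p x))"
proof -
  obtain K where K: "\<And>u v. \<bar>u \<bullet> (A *v v)\<bar> \<le> K * norm u * norm v"
    using bilinear_form_bound[of A] by blast
  have p': "p \<in> borel_measurable (lebesgue_on S)" "integrable (lebesgue_on S) (\<lambda>x. (norm (p x))\<^sup>2)"
    using p by (auto simp: L2_on_def)
  have "(\<lambda>v. v \<bullet> (A *v v)) \<in> borel_measurable borel"
    by (intro borel_measurable_continuous_onI continuous_intros)
  from measurable_compose[OF p'(1) this]
  show ?thesis
    by (intro Bochner_Integration.integrable_bound[OF integrable_mult_right[OF p'(2), of K]])
      (auto simp: power2_eq_square mult.assoc[symmetric] intro!: AE_I2 order_trans[OF K])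
qed

text \<open>Expanding around the limit leaves a square of the difference and two cross terms.
  Young's inequality with a free parameter \<open>e\<close> splits the cross terms pointwise, which
  bounds the error by \<open>K * (1 + 1 / e) * D n + K * e * N\<close>. First \<open>e\<close> is
  made small, then \<open>n\<close> large.\<close>

lemma L2_tendsto_quadratic_form:
  fixes A :: "real ^ 2 ^ 2"
  assumes P: "L2_tendsto S P p"
  shows "(\<lambda>n. LINT x | lebesgue_on S. P n x \<bullet> (A *v P n x)) \<longlonglongrightarrow>
    (LINT x | lebesgue_on S. p x \<bullet> (A *v p x))"
proof -
  let ?M = "lebesgue_on S"
  define D where "D n = (LINT x | ?M. (norm (P n x - p x))\<^sup>2)" for n
  define N where "N = (LINT x | ?M. (norm (p x))\<^sup>2)"
  obtain K where "K \<ge> 0" and K: "\<And>u v. \<bar>u \<bullet> (A *v v)\<bar> \<le> K * norm u * norm v"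
    using bilinear_form_bound[of A] by blast
  have Pn: "L2_on S (P n)" and p: "L2_on S p" and D: "D \<longlonglongrightarrow> 0" for n
    using P by (auto simp: L2_tendsto_def D_def[abs_def])
  have N: "N \<ge> 0"
    unfolding N_def by simp
  \<comment> \<open>\<open>L2_tendsto\<close> states square integrability of \<open>P n\<close> and
    \<open>p\<close> separately. That of the difference ensures that \<open>D n\<close> is a true
    integral and not the default value 0.\<close>
  have intD: "integrable ?M (\<lambda>x. (norm (P n x - p x))\<^sup>2)" for n
  proof -
    have m: "P n \<in> borel_measurable ?M" "p \<in> borel_measurable ?M"
      and i: "integrable ?M (\<lambda>x. (norm (P n x))\<^sup>2)" "integrable ?M (\<lambda>x. (norm (p x))\<^sup>2)"
      using Pn[of n] p by (auto simp: L2_on_def)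
    have "(norm (u - v))\<^sup>2 \<le> 2 * (norm u)\<^sup>2 + 2 * (norm v)\<^sup>2" for u v :: "real ^ 2"
      using power_mono[OF norm_triangle_ineq4[of u v], of 2] sum_squares_bound[of "norm u" "norm v"]
      by (simp add: power2_sum)
    thus ?thesis
      using m i by (intro Bochner_Integration.integrable_bound
        [OF Bochner_Integration.integrable_add[OF integrable_mult_right[OF i(1), of 2] integrable_mult_right[OF i(2), of 2]]])
        auto
  qed
  have est: "\<bar>(LINT x | ?M. P n x \<bullet> (A *v P n x)) - (LINT x | ?M. p x \<bullet> (A *v p x))\<bar>
      \<le> K * (1 + 1 / e) * D n + K * e * N" if e: "e > 0" for e n
  proof -
    have pt: "\<bar>u \<bullet> (A *v u) - v \<bullet> (A *v v)\<bar> \<le> K * (1 + 1 / e) * (norm (u - v))\<^sup>2 + K * e * (norm v)\<^sup>2"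
      for u v :: "real ^ 2"
    proof -
      define w where "w = u - v"
      have u: "u = v + w"
        by (simp add: w_def)
      have "u \<bullet> (A *v u) - v \<bullet> (A *v v) = w \<bullet> (A *v w) + v \<bullet> (A *v w) + w \<bullet> (A *v v)"
        by (simp add: u matrix_vector_right_distrib inner_add_left inner_add_right)
      also have "\<bar>\<dots>\<bar> \<le> K * norm w * norm w + K * norm v * norm w + K * norm w * norm v"
        using K[of w w] K[of v w] K[of w v] by linarith
      also have "\<dots> = K * ((norm w)\<^sup>2 + 2 * norm v * norm w)"
        by (simp add: power2_eq_square algebra_simps)
      also have "\<dots> \<le> K * ((norm w)\<^sup>2 + (e * (norm v)\<^sup>2 + (1 / e) * (norm w)\<^sup>2))"
      proof (intro mult_left_mono add_left_mono)
        have "0 \<le> (e * norm v - norm w)\<^sup>2 / e"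
          using e by simp
        also have "\<dots> = e * (norm v)\<^sup>2 + (1 / e) * (norm w)\<^sup>2 - 2 * norm v * norm w"
          using e by (simp add: power2_eq_square field_simps)
        finally show "2 * norm v * norm w \<le> e * (norm v)\<^sup>2 + (1 / e) * (norm w)\<^sup>2"
          by simp
      qed (rule \<open>K \<ge> 0\<close>)
      finally show ?thesis
        by (simp add: w_def algebra_simps)
    qed
    have i: "integrable ?M (\<lambda>x. P n x \<bullet> (A *v P n x))" "integrable ?M (\<lambda>x. p x \<bullet> (A *v p x))"
      "integrable ?M (\<lambda>x. (norm (p x))\<^sup>2)"
      using L2_on_quadratic_form_integrable Pn p by (auto simp: L2_on_def)
    have "\<bar>(LINT x | ?M. P n x \<bullet> (A *v P n x)) - (LINT x | ?M. p x \<bullet> (A *v p x))\<bar> =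
        \<bar>LINT x | ?M. P n x \<bullet> (A *v P n x) - p x \<bullet> (A *v p x)\<bar>"
      using i by simp
    also have "\<dots> \<le> (LINT x | ?M. \<bar>P n x \<bullet> (A *v P n x) - p x \<bullet> (A *v p x)\<bar>)"
      by (rule integral_abs_bound)
    also have "\<dots> \<le> (LINT x | ?M. K * (1 + 1 / e) * (norm (P n x - p x))\<^sup>2 + K * e * (norm (p x))\<^sup>2)"
      using i intD[of n] by (intro integral_mono pt) auto
    also have "\<dots> = K * (1 + 1 / e) * D n + K * e * N"
      using i intD[of n] by (simp add: D_def N_def)
    finally show ?thesis .
  qed
  show ?thesis
  proof (rule LIMSEQ_I)
    fix r :: real
    assume r: "r > 0"
    \<comment> \<open>This makes \<open>K * e * N\<close> at most \<open>r / 2\<close>; the summand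
      1 keeps the denominator positive when \<open>K * N\<close> vanishes.\<close>
    define e where "e = r / (2 * (K * N + 1))"
    have KN: "K * N + 1 > 0"
      using \<open>K \<ge> 0\<close> N by (simp add: add_nonneg_pos)
    have e: "e > 0"
      using r KN by (simp add: e_def)
    have "K * e * N = (r / 2) * (K * N / (K * N + 1))"
      using KN by (simp add: e_def)
    also have "\<dots> \<le> r / 2 * 1"
      using r KN by (intro mult_left_mono) auto
    finally have eN: "K * e * N \<le> r / 2" by simp
    have "(\<lambda>n. K * (1 + 1 / e) * D n) \<longlonglongrightarrow> 0"
      using tendsto_mult_right_zero[OF D] .
    then obtain n0 where n0: "\<And>n. n \<ge> n0 \<Longrightarrow> \<bar>K * (1 + 1 / e) * D n\<bar> < r / 2"
      using LIMSEQ_D[of _ 0 "r / 2"] r by (metis diff_zero half_gt_zero real_norm_def)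
    show "\<exists>n0. \<forall>n\<ge>n0. norm ((LINT x | ?M. P n x \<bullet> (A *v P n x)) - (LINT x | ?M. p x \<bullet> (A *v p x))) < r"
    proof (intro exI[of _ n0] allI impI)
      fix n
      assume "n \<ge> n0"
      show "norm ((LINT x | ?M. P n x \<bullet> (A *v P n x)) - (LINT x | ?M. p x \<bullet> (A *v p x))) < r"
        unfolding real_norm_def using est[OF e, of n] n0[OF \<open>n \<ge> n0\<close>] eN by linarith
    qed
  qed
qed


section \<open>Joint continuity from partial derivatives\<close>

text \<open>Continuous partial derivatives are bounded on a compact product. Going from one point to
  another along one coordinate at a time, the mean value inequality gives a Lipschitz bound.
  \<open>classical_pde\<close> asks for continuity of the derivatives only, so that of the field is
  obtained here.\<close>

lemma continuous_on_bounded_partial_derivatives: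
  fixes q :: "real \<Rightarrow> real \<Rightarrow> 'a::real_normed_vector"
  assumes S: "compact S" "convex S" and T: "compact T" "convex T"
    and qx: "\<And>x t. x \<in> S \<Longrightarrow> t \<in> T \<Longrightarrow> ((\<lambda>y. q y t) has_vector_derivative qx x t) (at x within S)"
    and qt: "\<And>x t. x \<in> S \<Longrightarrow> t \<in> T \<Longrightarrow> ((\<lambda>s. q x s) has_vector_derivative qt x t) (at t within T)"
    and contx: "continuous_on (S \<times> T) (\<lambda>(x, t). qx x t)"
    and contt: "continuous_on (S \<times> T) (\<lambda>(x, t). qt x t)"
  shows "continuous_on (S \<times> T) (\<lambda>(x, t). q x t)"
proof -
  have "bounded ((\<lambda>(x, t). qx x t) ` (S \<times> T))" "bounded ((\<lambda>(x, t). qt x t) ` (S \<times> T))"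
    using compact_continuous_image[OF contx] compact_continuous_image[OF contt] S T
    by (auto intro!: compact_imp_bounded compact_Times)
  then obtain A B where "A > 0" "B > 0"
    and A: "\<And>x t. x \<in> S \<Longrightarrow> t \<in> T \<Longrightarrow> norm (qx x t) \<le> A"
    and B: "\<And>x t. x \<in> S \<Longrightarrow> t \<in> T \<Longrightarrow> norm (qt x t) \<le> B"
    unfolding bounded_pos by fastforce
  \<comment> \<open>The mean value inequality bounds the operator norm of the derivative, here the
    map multiplying a fixed vector by a scalar.\<close>
  have on: "onorm (\<lambda>h. h *\<^sub>R v) \<le> norm v" for v :: 'a
    by (rule onorm_le) (simp add: mult.commute)
  have "(A + B)-lipschitz_on (S \<times> T) (\<lambda>(x, t). q x t)"
  proof (rule lipschitz_onI)
    fix z z'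
    assume "z \<in> S \<times> T" "z' \<in> S \<times> T"
    then obtain x t y s where z: "z = (x, t)" "z' = (y, s)" and xy: "x \<in> S" "y \<in> S" "t \<in> T" "s \<in> T"
      by auto
    have "norm (q x t - q y t) \<le> A * norm (x - y)"
      by (rule differentiable_bound[OF S(2), of "\<lambda>y. q y t" "\<lambda>x h. h *\<^sub>R qx x t"])
        (use qx A xy in \<open>auto simp: has_vector_derivative_def intro: order_trans[OF on]\<close>)
    moreover have "norm (q y t - q y s) \<le> B * norm (t - s)"
      by (rule differentiable_bound[OF T(2), of "\<lambda>s. q y s" "\<lambda>t h. h *\<^sub>R qt y t"])
        (use qt B xy in \<open>auto simp: has_vector_derivative_def intro: order_trans[OF on]\<close>)
    moreover have "A * norm (x - y) \<le> A * dist z z'" "B * norm (t - s) \<le> B * dist z z'"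
      using dist_fst_le[of z z'] dist_snd_le[of z z'] \<open>A > 0\<close> \<open>B > 0\<close>
      by (auto simp: z dist_norm intro!: mult_left_mono)
    ultimately show "dist (case z of (x, t) \<Rightarrow> q x t) (case z' of (x, t) \<Rightarrow> q x t) \<le> (A + B) * dist z z'"
      using norm_triangle_ineq[of "q x t - q y t" "q y t - q y s"]
      by (simp add: z dist_norm[of "q x t"] distrib_right)
  qed (use \<open>A > 0\<close> \<open>B > 0\<close> in simp)
  thus ?thesis
    by (rule lipschitz_on_continuous_on)
qed

section \<open>Eigenvalues and the sign of the boundary term\<close>

lemma transpose_weight_matrix: "transpose (weight_matrix g H) = weight_matrix g H"
  by (simp add: weight_matrix_def transpose_def vec_eq_iff forall_2)

text \<open>The weight \<open>W\<close> is a symmetrizer of the system: it turns both off-diagonal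
  entries of \<open>M\<close> into \<open>g * H\<close>.\<close>

lemma transpose_sym_matrix: "transpose (sym_matrix g H U) = sym_matrix g H U"
  by (simp add: sym_matrix_def weight_matrix_def flux_matrix_def transpose_def vec_eq_iff forall_2
      matrix_matrix_mult_def sum_2)

text \<open>The square root cancels because the integrand is a sum of squares with nonnegative
  weights \<open>g\<close> and \<open>H\<close>.\<close>

lemma W_norm_squared:
  assumes "g \<ge> 0" "H \<ge> 0"
  shows "(W_norm g H p)\<^sup>2 = (LINT x | lebesgue_on {0..1}. p x \<bullet> (weight_matrix g H *v p x))"
proof -
  have "v \<bullet> (weight_matrix g H *v v) = g * (v $ 1)\<^sup>2 + H * (v $ 2)\<^sup>2" for v :: "real ^ 2"
    by (simp add: weight_matrix_def inner_vec_def matrix_vector_mult_def sum_2 power2_eq_square)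
  hence "0 \<le> (LINT x | lebesgue_on {0..1}. p x \<bullet> (weight_matrix g H *v p x))"
    using assms by (intro integral_nonneg_AE) simp
  thus ?thesis
    by (simp add: W_norm_def)
qed

lemma BT_scaled:
  assumes "g > 0" "H > 0"
  shows "g * H * BT g H U p =
    - (1 / 2) * (p 1 \<bullet> (sym_matrix g H U *v p 1) - p 0 \<bullet> (sym_matrix g H U *v p 0))"
  using assms by (simp add: BT_def field_simps)

text \<open>The discriminant is a sum of two squares, the second being that of
  \<open>2 * g * H\<close>, which is never zero.\<close>

lemma lambda_discriminant_pos:
  fixes g H U :: real
  assumes "g > 0" "H > 0"
  shows "U\<^sup>2 * (g + H)\<^sup>2 + 4 * g * H * (g * H - U\<^sup>2) > 0"
proof -
  have "U\<^sup>2 * (g + H)\<^sup>2 + 4 * g * H * (g * H - U\<^sup>2) = U\<^sup>2 * (g - H)\<^sup>2 + (2 * g * H)\<^sup>2"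
    by (simp add: power2_eq_square algebra_simps)
  also have "\<dots> > 0"
    using assms by (intro add_nonneg_pos) auto
  finally show ?thesis .
qed

text \<open>A difference of squares in which the root disappears. The sign of the product tells the
  three flow regimes apart.\<close>

lemma lambda_prod:
  assumes "g > 0" "H > 0"
  shows "lambda1 g H U * lambda2 g H U = (U\<^sup>2 - g * H) / (g * H)"
proof -
  define R where "R = sqrt (U\<^sup>2 * (g + H)\<^sup>2 + 4 * g * H * (g * H - U\<^sup>2))"
  have "R\<^sup>2 = U\<^sup>2 * (g + H)\<^sup>2 + 4 * g * H * (g * H - U\<^sup>2)"
    unfolding R_def using lambda_discriminant_pos[OF assms, of U] by simp
  hence "(U * (g + H))\<^sup>2 - R\<^sup>2 = 4 * g * H * (U\<^sup>2 - g * H)"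
    by (simp add: power2_eq_square algebra_simps)
  moreover have "lambda1 g H U * lambda2 g H U = ((U * (g + H))\<^sup>2 - R\<^sup>2) / (2 * g * H)\<^sup>2"
    unfolding lambda1_def lambda2_def R_def[symmetric]
    by (simp add: power2_eq_square algebra_simps add_divide_distrib diff_divide_distrib)
  ultimately have "lambda1 g H U * lambda2 g H U = 4 * g * H * (U\<^sup>2 - g * H) / (2 * g * H)\<^sup>2"
    by simp
  also have "\<dots> = (U\<^sup>2 - g * H) / (g * H)"
    using assms by (simp add: power2_eq_square)
  finally show ?thesis .
qed

lemma lambda_sum:
  assumes "g > 0" "H > 0"
  shows "lambda1 g H U + lambda2 g H U = U * (g + H) / (g * H)"
  using assms by (simp add: lambda1_def lambda2_def field_simps)

lemma lambda2_less_lambda1: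
  assumes "g > 0" "H > 0"
  shows "lambda2 g H U < lambda1 g H U"
proof -
  have "sqrt (U\<^sup>2 * (g + H)\<^sup>2 + 4 * g * H * (g * H - U\<^sup>2)) > 0"
    using lambda_discriminant_pos[OF assms] by simp
  thus ?thesis
    unfolding lambda1_def lambda2_def using assms by (intro mult_strict_left_mono) auto
qed

text \<open>Product, sum and order of the eigenvalues fix their signs in each regime. In
  characteristic variables the boundary conditions then remove or dominate every contribution that
  would feed energy in.\<close>

lemma BT_nonpos:
  assumes gH: "g > 0" "H > 0"
    and \<gamma>: "U\<^sup>2 < g * H \<Longrightarrow>
           \<gamma>0\<^sup>2 \<le> - lambda2 g H U / lambda1 g H U \<and> \<gamma>1\<^sup>2 \<le> - lambda1 g H U / lambda2 g H U"
    and bc: "boundary_conditions g H U \<gamma>0 \<gamma>1 p"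
  shows "BT g H U p \<le> 0"
proof -
  define l1 l2 where "l1 = lambda1 g H U" and "l2 = lambda2 g H U"
  have prod: "l1 * l2 = (U\<^sup>2 - g * H) / (g * H)" and sum: "l1 + l2 = U * (g + H) / (g * H)"
    and less: "l2 < l1"
    unfolding l1_def l2_def using gH lambda_prod lambda_sum lambda2_less_lambda1 by auto
  have gH0: "g * H > 0" "g + H > 0"
    using gH by auto
  have sum_pos: "l1 + l2 > 0" if "U > 0"
    using that gH0 unfolding sum by simp
  have sum_neg: "l1 + l2 < 0" if "U < 0"
    using that gH0 unfolding sum by (simp add: divide_neg_pos mult_neg_pos)
  define a0 b0 a1 b1 where ab: "a0 = w1 g H U (p 0)" "b0 = w2 g H U (p 0)"
    "a1 = w1 g H U (p 1)" "b1 = w2 g H U (p 1)"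
  have BT: "BT g H U p = 1 / 2 * (l1 * a0\<^sup>2 + l2 * b0\<^sup>2) - 1 / 2 * (l1 * a1\<^sup>2 + l2 * b1\<^sup>2)"
    unfolding ab l1_def l2_def by (rule BT_characteristic[OF gH])
  note bc = bc[unfolded boundary_conditions_def, folded ab]
  \<comment> \<open>The case \<open>U = 0\<close> is sub-critical because \<open>g * H\<close> is
    positive, so the other regimes have a flow direction.\<close>
  consider "U\<^sup>2 < g * H" | "U\<^sup>2 > g * H" "U > 0" | "U\<^sup>2 > g * H" "U < 0"
    | "U\<^sup>2 = g * H" "U > 0" | "U\<^sup>2 = g * H" "U < 0"
    using gH0 by (cases U "0 :: real" rule: linorder_cases) fastforce+
  thus ?thesis
  proof cases
    case 1
    have "l1 * l2 < 0"
      using 1 gH0 by (simp add: prod divide_neg_pos)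
    hence l: "l1 > 0" "l2 < 0"
      using less by (auto simp: mult_less_0_iff)
    have "\<gamma>0\<^sup>2 \<le> - l2 / l1" "\<gamma>1\<^sup>2 \<le> - l1 / l2"
      using \<gamma>[OF 1] by (auto simp: l1_def l2_def)
    \<comment> \<open>Clearing the denominators reverses the second inequality, since
      \<open>l2\<close> is negative. The results are the coefficients of the squares of
      \<open>b0\<close> and \<open>a1\<close> once the boundary conditions are substituted.\<close>
    hence "l1 * \<gamma>0\<^sup>2 + l2 \<le> 0" "0 \<le> l1 + l2 * \<gamma>1\<^sup>2"
      using l by (simp_all add: field_simps)
    hence "(l1 * \<gamma>0\<^sup>2 + l2) * b0\<^sup>2 \<le> 0" "0 \<le> (l1 + l2 * \<gamma>1\<^sup>2) * a1\<^sup>2"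
      by (simp_all add: mult_nonpos_nonneg)
    moreover have "a0 = \<gamma>0 * b0" "b1 = \<gamma>1 * a1"
      using bc 1 by auto
    ultimately show ?thesis
      by (simp add: BT power_mult_distrib algebra_simps)
  next
    case 2
    have "l1 * l2 > 0"
      using 2 gH0 by (simp add: prod)
    \<comment> \<open>Equal signs and a positive sum. With the inflow terms at 0 removed, only the
      outflow terms at 1 remain, and they enter with a minus sign.\<close>
    hence "l1 > 0" "l2 > 0"
      using sum_pos 2 by (auto simp: zero_less_mult_iff)
    thus ?thesis
      using bc 2 by (simp add: BT)
  next
    case 3
    have "l1 * l2 > 0"
      using 3 gH0 by (simp add: prod)
    hence "l1 < 0" "l2 < 0"
      using sum_neg 3 by (auto simp: zero_less_mult_iff)
    thus ?thesis
      using bc 3 by (simp add: BT mult_nonpos_nonneg add_nonpos_nonpos)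
  next
    case 4
    have "l1 * l2 = 0"
      using 4 gH0 by (simp add: prod)
    \<comment> \<open>One eigenvalue vanishes; as the sum is positive, it is the smaller
      one.\<close>
    hence "l1 > 0" "l2 = 0"
      using sum_pos less 4 by auto
    thus ?thesis
      using bc 4 by (simp add: BT)
  next
    case 5
    have "l1 * l2 = 0"
      using 5 gH0 by (simp add: prod)
    hence "l1 = 0" "l2 < 0"
      using sum_neg less 5 by auto
    thus ?thesis
      using bc 5 by (simp add: BT mult_nonpos_nonneg)
  qed
qed

section \<open>Energy identity for classical solutions\<close>

text \<open>Time is cut off at \<open>T\<close> because the bound on the partial derivatives needs a
  compact domain.\<close>

lemma classical_pde_continuous:
  assumes "classical_pde g H U q"
  shows "continuous_on ({0..1} \<times> {0..T}) (\<lambda>(x, t). q x t)"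
proof -
  from assms obtain qt qx where cont: "continuous_on ({0..1} \<times> {0..}) (\<lambda>(x, t). qt x t)"
      "continuous_on ({0..1} \<times> {0..}) (\<lambda>(x, t). qx x t)"
    and d: "\<And>x t. x \<in> {0..1} \<Longrightarrow> t \<ge> 0 \<Longrightarrow> ((\<lambda>s. q x s) has_vector_derivative qt x t) (at t within {0..})"
      "\<And>x t. x \<in> {0..1} \<Longrightarrow> t \<ge> 0 \<Longrightarrow> ((\<lambda>y. q y t) has_vector_derivative qx x t) (at x within {0..1})"
    unfolding classical_pde_def by blast
  show ?thesis
    by (rule continuous_on_bounded_partial_derivatives[where qx = qx and qt = qt])
      (auto intro!: d intro: has_vector_derivative_within_subset[OF d(1)] continuous_on_subset[OF cont(1)]
        continuous_on_subset[OF cont(2)])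
qed

lemma classical_pde_continuous_slice:
  assumes "classical_pde g H U q" "t \<ge> 0"
  shows "continuous_on {0..1} (\<lambda>x. q x t)"
  by (rule continuous_on_compose2[OF classical_pde_continuous[OF assms(1), of t],
        of _ "\<lambda>x. (x, t)", simplified])
    (use assms(2) in \<open>auto intro!: continuous_intros\<close>)

lemma classical_energy_derivative:
  assumes gH: "g > 0" "H > 0" and pde: "classical_pde g H U q" and t: "t \<ge> 0"
  shows "((\<lambda>s. 1 / 2 * (W_norm g H (\<lambda>x. q x s))\<^sup>2) has_real_derivative
    g * H * BT g H U (\<lambda>x. q x t)) (at t within {0..})"
proof -
  \<comment> \<open>The interval \<open>?T\<close> is bounded, so joint continuity is at hand, and
    reaches beyond \<open>t\<close>, so it contains all times near \<open>t\<close> in the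
    half-line.\<close>
  let ?W = "weight_matrix g H" and ?S = "sym_matrix g H U" and ?T = "{0..t + 1}"
  from pde obtain qt qx where cont: "continuous_on ({0..1} \<times> {0..}) (\<lambda>(x, t). qt x t)"
    and d: "\<And>x t. x \<in> {0..1} \<Longrightarrow> t \<ge> 0 \<Longrightarrow> ((\<lambda>s. q x s) has_vector_derivative qt x t) (at t within {0..})"
      "\<And>x t. x \<in> {0..1} \<Longrightarrow> t \<ge> 0 \<Longrightarrow> ((\<lambda>y. q y t) has_vector_derivative qx x t) (at x within {0..1})"
    and eq: "\<And>x t. x \<in> {0..1} \<Longrightarrow> t \<ge> 0 \<Longrightarrow> qt x t = - (flux_matrix g H U *v qx x t)"
    unfolding classical_pde_def by blast
  define e where "e s x = 1 / 2 * (q x s \<bullet> (?W *v q x s))" for s x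
  have e_cont: "continuous_on {0..1} (e s)" if "s \<ge> 0" for s
    unfolding e_def by (intro continuous_intros classical_pde_continuous_slice[OF pde that])
  \<comment> \<open>The Leibniz rule has the parameter, here time, as the first coordinate.\<close>
  have swap: "continuous_on (?T \<times> {0..1}) (\<lambda>(s, x). q x s)"
    "continuous_on (?T \<times> {0..1}) (\<lambda>(s, x). qt x s)"
  proof -
    have "continuous_on (?T \<times> {0..1}) prod.swap" "prod.swap ` (?T \<times> {0..1}) \<subseteq> {0..1} \<times> ?T"
      by (auto intro: continuous_on_swap)
    from continuous_on_compose2[OF classical_pde_continuous[OF pde] this]
      continuous_on_compose2[OF continuous_on_subset[OF cont] this]
    show "continuous_on (?T \<times> {0..1}) (\<lambda>(s, x). q x s)"
      "continuous_on (?T \<times> {0..1}) (\<lambda>(s, x). qt x s)"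
      by (simp_all add: case_prod_unfold subset_iff)
  qed
  have "((\<lambda>s. integral (cbox 0 1) (e s)) has_real_derivative
      integral (cbox 0 1) (\<lambda>x. q x t \<bullet> (?W *v qt x t))) (at t within ?T)"
  proof (rule leibniz_rule_field_derivative[where fx = "\<lambda>s x. q x s \<bullet> (?W *v qt x s)"])
    fix s x :: real
    assume sx: "s \<in> ?T" "x \<in> cbox 0 1"
    have "((\<lambda>s. q x s) has_vector_derivative qt x s) (at s within ?T)"
      by (rule has_vector_derivative_within_subset[OF d(1)]) (use sx in auto)
    from DERIV_cmult[OF quadratic_form_has_derivative[OF transpose_weight_matrix this, of g H], of "1 / 2"]
    show "((\<lambda>s. e s x) has_real_derivative q x s \<bullet> (?W *v qt x s)) (at s within ?T)"
      unfolding e_def by simp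
  next
    show "e s integrable_on cbox 0 1" if "s \<in> ?T" for s
      using e_cont[of s] that integrable_continuous[of 0 1 "e s"] by simp
    show "continuous_on (?T \<times> cbox 0 1) (\<lambda>(s, x). q x s \<bullet> (?W *v qt x s))"
      using swap by (auto simp: case_prod_unfold intro!: continuous_intros)
  qed (use t in auto)
  moreover have "((\<lambda>x. q x t \<bullet> (?W *v qt x t)) has_integral
      - (1 / 2) * (q 1 t \<bullet> (?S *v q 1 t)) - - (1 / 2) * (q 0 t \<bullet> (?S *v q 0 t))) {0..1}"
  proof (rule fundamental_theorem_of_calculus)
    fix x :: real
    assume x: "x \<in> {0..1}"
    \<comment> \<open>The differential equation multiplied by \<open>W\<close>: it trades the time
      derivative for an exact space derivative.\<close>
    have "?S *v qx x t = - (?W *v qt x t)"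
      using eq[OF x t] by (simp add: sym_matrix_def matrix_vector_mul_assoc[symmetric] vec.neg)
    with DERIV_cmult[OF quadratic_form_has_derivative[OF transpose_sym_matrix d(2)[OF x t], of g H U], of "- (1 / 2)"]
    show "((\<lambda>x. - (1 / 2) * (q x t \<bullet> (?S *v q x t))) has_vector_derivative q x t \<bullet> (?W *v qt x t))
        (at x within {0..1})"
      by (simp add: has_real_derivative_iff_has_vector_derivative)
  qed simp
  hence "integral (cbox 0 1) (\<lambda>x. q x t \<bullet> (?W *v qt x t)) = g * H * BT g H U (\<lambda>x. q x t)"
    unfolding BT_scaled[OF gH] by (simp add: integral_unique algebra_simps)
  moreover have "at t within ?T = at t within {0..}"
    by (rule at_within_nhd[of t "{..<t + 1}"]) auto
  ultimately have "((\<lambda>s. integral (cbox 0 1) (e s)) has_real_derivative g * H * BT g H U (\<lambda>x. q x t))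
      (at t within {0..})"
    by simp
  moreover have "integral (cbox 0 1) (e s) = 1 / 2 * (W_norm g H (\<lambda>x. q x s))\<^sup>2" if "s \<in> {0..}" for s
  proof -
    have "integral (cbox 0 1) (e s) = (LINT x | lebesgue_on {0..1}. e s x)"
      using lebesgue_integral_eq_integral[OF continuous_imp_integrable_real[OF e_cont[of s]]] that by simp
    thus ?thesis
      using gH by (simp add: W_norm_squared e_def)
  qed
  ultimately show ?thesis
    using t by (auto intro: has_field_derivative_transform_within[where d = 1])
qed


section \<open>Passage to generalized solutions\<close>

text \<open>The integrated form involves only energies at fixed times and a time integral of
  boundary values, all of which survive mean-square limits.\<close>

lemma classical_energy_has_integral:
  assumes gH: "g > 0" "H > 0" and pde: "classical_pde g H U q" and st: "0 \<le> s" "s \<le> t"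
  shows "((\<lambda>r. g * H * BT g H U (\<lambda>x. q x r)) has_integral
    1 / 2 * (W_norm g H (\<lambda>x. q x t))\<^sup>2 - 1 / 2 * (W_norm g H (\<lambda>x. q x s))\<^sup>2) {s..t}"
proof (rule fundamental_theorem_of_calculus[OF st(2)])
  fix r
  assume "r \<in> {s..t}"
  thus "((\<lambda>s. 1 / 2 * (W_norm g H (\<lambda>x. q x s))\<^sup>2) has_vector_derivative
      g * H * BT g H U (\<lambda>x. q x r)) (at r within {s..t})"
    unfolding has_real_derivative_iff_has_vector_derivative[symmetric]
    using st by (intro has_field_derivative_subset[OF classical_energy_derivative[OF gH pde]]) auto
qed

text \<open>The identity holds for each approximation \<open>Q n\<close>. The energies converge by
  convergence at times 0 and \<open>t\<close>, the boundary integral by convergence of the traces,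
  and uniqueness of limits concludes.\<close>

lemma generalized_energy_has_integral:
  assumes gH: "g > 0" "H > 0" and f: "L2_on {0..1} f"
    and q: "generalized_solution g H U \<gamma>0 \<gamma>1 f q" and t: "t \<ge> 0"
  shows "((\<lambda>s. g * H * BT g H U (\<lambda>x. q x s)) has_integral
    1 / 2 * (W_norm g H (\<lambda>x. q x t))\<^sup>2 - 1 / 2 * (W_norm g H f)\<^sup>2) {0..t}"
proof -
  let ?W = "weight_matrix g H" and ?S = "sym_matrix g H U"
  from q obtain Q where init: "AE x in lebesgue_on {0..1}. q x 0 = f x"
    and sol: "\<And>n. classical_solution g H U \<gamma>0 \<gamma>1 (\<lambda>x. Q n x 0) (Q n)"
    and lim: "\<And>t. t \<ge> 0 \<Longrightarrow> L2_tendsto {0..1} (\<lambda>n x. Q n x t) (\<lambda>x. q x t)"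
    and trace: "\<And>T. T > 0 \<Longrightarrow> L2_tendsto {0..T} (\<lambda>n t. Q n 0 t) (\<lambda>t. q 0 t)"
      "\<And>T. T > 0 \<Longrightarrow> L2_tendsto {0..T} (\<lambda>n t. Q n 1 t) (\<lambda>t. q 1 t)"
    unfolding generalized_solution_def by blast
  define E where "E p = 1 / 2 * (W_norm g H p)\<^sup>2" for p
  have E: "E p = 1 / 2 * (LINT x | lebesgue_on {0..1}. p x \<bullet> (?W *v p x))" for p
    unfolding E_def using gH by (simp add: W_norm_squared)
  \<comment> \<open>The initial datum is attained only almost everywhere, so it is exchanged under
    the integral.\<close>
  have "(LINT x | lebesgue_on {0..1}. q x 0 \<bullet> (?W *v q x 0)) =
      (LINT x | lebesgue_on {0..1}. f x \<bullet> (?W *v f x))"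
  proof (rule integral_cong_AE)
    show "AE x in lebesgue_on {0..1}. q x 0 \<bullet> (?W *v q x 0) = f x \<bullet> (?W *v f x)"
      using init by eventually_elim simp
    have "L2_on {0..1} (\<lambda>x. q x 0)"
      using lim[of 0] by (simp add: L2_tendsto_def)
    thus "(\<lambda>x. q x 0 \<bullet> (?W *v q x 0)) \<in> borel_measurable (lebesgue_on {0..1})"
      using L2_on_quadratic_form_integrable by blast
    show "(\<lambda>x. f x \<bullet> (?W *v f x)) \<in> borel_measurable (lebesgue_on {0..1})"
      using L2_on_quadratic_form_integrable[OF f] by blast
  qed
  hence E0: "E (\<lambda>x. q x 0) = E f"
    by (simp add: E)
  show ?thesis
  \<comment> \<open>Trace convergence is provided for positive time horizons; at time 0 both sides
    vanish.\<close>
  proof (cases "t = 0")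
    case True
    thus ?thesis
      using E0 by (simp add: E_def has_integral_refl)
  next
    case False
    hence t0: "t > 0"
      using t by simp
    let ?M = "lebesgue_on {0..t}"
    have i: "integrable ?M (\<lambda>s. Q n 0 s \<bullet> (?S *v Q n 0 s))" "integrable ?M (\<lambda>s. Q n 1 s \<bullet> (?S *v Q n 1 s))"
      "integrable ?M (\<lambda>s. q 0 s \<bullet> (?S *v q 0 s))" "integrable ?M (\<lambda>s. q 1 s \<bullet> (?S *v q 1 s))" for n
      using trace[OF t0] by (auto simp: L2_tendsto_def intro!: L2_on_quadratic_form_integrable)
    have int: "integrable ?M (\<lambda>s. g * H * BT g H U (\<lambda>x. Q n x s))"
      "integrable ?M (\<lambda>s. g * H * BT g H U (\<lambda>x. q x s))" for n
      unfolding BT_scaled[OF gH] using i by auto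
    have "(\<lambda>n. LINT s | ?M. g * H * BT g H U (\<lambda>x. Q n x s)) \<longlonglongrightarrow>
        (LINT s | ?M. g * H * BT g H U (\<lambda>x. q x s))"
      unfolding BT_scaled[OF gH] using i
      by (simp, intro tendsto_intros L2_tendsto_quadratic_form trace[OF t0]) simp
    \<comment> \<open>The classical identity is a gauge integral and the limits are Lebesgue
      integrals; uniqueness of the integral identifies the two.\<close>
    moreover have "(LINT s | ?M. g * H * BT g H U (\<lambda>x. Q n x s)) = E (\<lambda>x. Q n x t) - E (\<lambda>x. Q n x 0)" for n
      using has_integral_unique[OF has_integral_integral_lebesgue_on[OF int(1)[of n]]
          classical_energy_has_integral[OF gH _ order_refl t, of U "Q n"]] sol[of n]
      by (simp add: classical_solution_def E_def)
    moreover have "(\<lambda>n. E (\<lambda>x. Q n x t) - E (\<lambda>x. Q n x 0)) \<longlonglongrightarrow> E (\<lambda>x. q x t) - E (\<lambda>x. q x 0)"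
      unfolding E by (intro tendsto_intros L2_tendsto_quadratic_form lim t order_refl)
    ultimately have "(LINT s | ?M. g * H * BT g H U (\<lambda>x. q x s)) = E (\<lambda>x. q x t) - E f"
      unfolding E0[symmetric] by (simp add: LIMSEQ_unique)
    thus ?thesis
      using has_integral_integral_lebesgue_on[OF int(2)] by (simp add: E_def)
  qed
qed

text \<open>The boundary conditions act on the approximations, whose energies decrease, and weak
  inequalities between energies at fixed times pass to the limit.\<close>

lemma generalized_energy_antimono:
  assumes gH: "g > 0" "H > 0"
    and \<gamma>: "U\<^sup>2 < g * H \<Longrightarrow>
           \<gamma>0\<^sup>2 \<le> - lambda2 g H U / lambda1 g H U \<and> \<gamma>1\<^sup>2 \<le> - lambda1 g H U / lambda2 g H U"
    and q: "generalized_solution g H U \<gamma>0 \<gamma>1 f q" and st: "0 \<le> s" "s \<le> t"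
  shows "(W_norm g H (\<lambda>x. q x t))\<^sup>2 \<le> (W_norm g H (\<lambda>x. q x s))\<^sup>2"
proof -
  from q obtain Q where
        sol: "\<And>n. classical_solution g H U \<gamma>0 \<gamma>1 (\<lambda>x. Q n x 0) (Q n)"
    and lim: "\<And>t. t \<ge> 0 \<Longrightarrow> L2_tendsto {0..1} (\<lambda>n x. Q n x t) (\<lambda>x. q x t)"
    unfolding generalized_solution_def by blast
  have "(\<lambda>n. (W_norm g H (\<lambda>x. Q n x r))\<^sup>2) \<longlonglongrightarrow> (W_norm g H (\<lambda>x. q x r))\<^sup>2" if "r \<ge> 0" for r
    using gH by (simp add: W_norm_squared L2_tendsto_quadratic_form[OF lim[OF that]])
  moreover have "(W_norm g H (\<lambda>x. Q n x t))\<^sup>2 \<le> (W_norm g H (\<lambda>x. Q n x s))\<^sup>2" for n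
  proof -
    have "1 / 2 * (W_norm g H (\<lambda>x. Q n x t))\<^sup>2 - 1 / 2 * (W_norm g H (\<lambda>x. Q n x s))\<^sup>2 \<le> 0"
    proof (rule has_integral_le[OF classical_energy_has_integral[OF gH _ st] has_integral_0])
      show "classical_pde g H U (Q n)"
        using sol[of n] by (simp add: classical_solution_def)
      show "g * H * BT g H U (\<lambda>x. Q n x r) \<le> 0" if "r \<in> {s..t}" for r
        using sol[of n] st that gH
        by (intro mult_nonneg_nonpos BT_nonpos[OF gH \<gamma>]) (auto simp: classical_solution_def)
    qed
    thus ?thesis by simp
  qed
  ultimately show ?thesis
    using st by (intro LIMSEQ_le[of "\<lambda>n. (W_norm g H (\<lambda>x. Q n x t))\<^sup>2" _ "\<lambda>n. (W_norm g H (\<lambda>x. Q n x s))\<^sup>2"]) auto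
qed

text \<open>Traces of a generalized solution are mean-square limits in time, so its derivative
  identity is stated almost everywhere. The integrated identity is stated as well, since an almost
  everywhere derivative alone does not determine a function.\<close>

theorem theorem8:
  fixes g H U \<gamma>0 \<gamma>1 :: real
    and f :: "real \<Rightarrow> real ^ 2"
    and q :: "real \<Rightarrow> real \<Rightarrow> real ^ 2"
  assumes "g > 0" and "H > 0"
    and "L2_on {0..1} f"
    and "U\<^sup>2 < g * H \<Longrightarrow>
           \<gamma>0\<^sup>2 \<le> - lambda2 g H U / lambda1 g H U \<and> \<gamma>1\<^sup>2 \<le> - lambda1 g H U / lambda2 g H U"
  shows "(classical_solution g H U \<gamma>0 \<gamma>1 f q \<longrightarrow>
            (\<forall>t\<ge>0.
               ((\<lambda>s. 1 / 2 * (W_norm g H (\<lambda>x. q x s))\<^sup>2) has_real_derivative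
                  g * H * BT g H U (\<lambda>x. q x t)) (at t within {0..}) \<and>
               g * H * BT g H U (\<lambda>x. q x t) \<le> 0)) \<and>
         (generalized_solution g H U \<gamma>0 \<gamma>1 f q \<longrightarrow>
            (\<forall>t\<ge>0. ((\<lambda>s. g * H * BT g H U (\<lambda>x. q x s)) has_integral
               1 / 2 * (W_norm g H (\<lambda>x. q x t))\<^sup>2 - 1 / 2 * (W_norm g H f)\<^sup>2) {0..t}) \<and>
            (AE t in lebesgue_on {0..}.
               ((\<lambda>s. 1 / 2 * (W_norm g H (\<lambda>x. q x s))\<^sup>2) has_real_derivative
                  g * H * BT g H U (\<lambda>x. q x t)) (at t within {0..}) \<and>
               g * H * BT g H U (\<lambda>x. q x t) \<le> 0))"
proof (intro conjI impI allI)
  fix t :: real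
  assume "classical_solution g H U \<gamma>0 \<gamma>1 f q" and t: "t \<ge> 0"
  hence "classical_pde g H U q" "boundary_conditions g H U \<gamma>0 \<gamma>1 (\<lambda>x. q x t)"
    by (auto simp: classical_solution_def)
  thus "((\<lambda>s. 1 / 2 * (W_norm g H (\<lambda>x. q x s))\<^sup>2) has_real_derivative
      g * H * BT g H U (\<lambda>x. q x t)) (at t within {0..})"
    and "g * H * BT g H U (\<lambda>x. q x t) \<le> 0"
    using classical_energy_derivative[OF assms(1,2) _ t] BT_nonpos[OF assms(1,2,4)] assms(1,2)
    by (simp_all add: mult_nonneg_nonpos)
next
  assume q: "generalized_solution g H U \<gamma>0 \<gamma>1 f q"
  define \<phi> where "\<phi> s = g * H * BT g H U (\<lambda>x. q x s)" for s
  define E where "E s = 1 / 2 * (W_norm g H (\<lambda>x. q x s))\<^sup>2" for s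
  \<comment> \<open>Extension by zero to negative times makes the function integrable on every
    bounded interval, as the differentiation lemma requires.\<close>
  define \<psi> where "\<psi> s = (if s \<in> {0..} then \<phi> s else 0)" for s
  have \<phi>: "(\<phi> has_integral E t - 1 / 2 * (W_norm g H f)\<^sup>2) {0..t}" if "t \<ge> 0" for t
    unfolding \<phi>_def E_def by (rule generalized_energy_has_integral[OF assms(1-3) q that])
  have "\<psi> integrable_on {a..b}" for a b
  proof -
    have "\<phi> integrable_on {0..max 0 b}"
      using \<phi>[of "max 0 b"] by (auto simp: integrable_on_def)
    hence "\<phi> integrable_on {max 0 a..b}"
      by (rule integrable_subinterval_real) auto
    moreover have "{0..} \<inter> {a..b} = {max 0 a..b}"
      by auto
    ultimately show ?thesis
      unfolding \<psi>_def[abs_def] integrable_restrict_Int by simp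
  qed
  from has_vector_derivative_indefinite_integral_ae[OF this] obtain N where N: "negligible N"
    and deriv: "\<And>x. x \<notin> N \<Longrightarrow> 0 < x \<Longrightarrow>
      ((\<lambda>s. integral {0..s} \<psi>) has_vector_derivative \<psi> x) (at x)"
    by blast
  have E_eq: "integral {0..s} \<psi> + 1 / 2 * (W_norm g H f)\<^sup>2 = E s" if "s > 0" for s
  proof -
    have "integral {0..s} \<psi> = integral {0..s} \<phi>"
      by (rule integral_cong) (simp add: \<psi>_def)
    thus ?thesis
      using \<phi>[of s] that by (simp add: integral_unique)
  qed
  \<comment> \<open>On positive times \<open>E\<close> is an indefinite integral plus a constant,
    and this open set suffices for a two-sided derivative.\<close>
  have E_deriv: "(E has_real_derivative \<phi> t) (at t)" if "t \<notin> N" "t > 0" for t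
  proof (rule has_field_derivative_transform_within_open)
    show "((\<lambda>s. integral {0..s} \<psi> + 1 / 2 * (W_norm g H f)\<^sup>2) has_real_derivative \<phi> t) (at t)"
      using deriv[OF that] that
      by (auto simp: \<psi>_def has_real_derivative_iff_has_vector_derivative[symmetric]
          intro!: derivative_eq_intros)
  qed (use that E_eq in \<open>auto intro: open_greaterThan[of 0]\<close>)
  \<comment> \<open>The sign is flipped because the derivative criterion speaks of nondecreasing
    functions.\<close>
  have "mono_on {0..} (\<lambda>s. - E s)"
    unfolding E_def using generalized_energy_antimono[OF assms(1,2,4) q]
    by (auto simp: mono_on_def)
  hence nonpos: "\<phi> t \<le> 0" if "t \<notin> N" "t > 0" for t
    using mono_on_imp_deriv_nonneg[OF _ DERIV_minus[OF E_deriv[OF that]], of "{0..}"] that by simp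
  \<comment> \<open>Time 0 joins the null set, as differentiability was shown at positive times
    only.\<close>
  have "AE t in lebesgue. t \<notin> insert 0 N"
    using N by (intro AE_not_in) (simp add: negligible_iff_null_sets)
  hence "AE t in lebesgue. t \<in> {0..} \<longrightarrow> (E has_real_derivative \<phi> t) (at t within {0..}) \<and> \<phi> t \<le> 0"
    by eventually_elim (use E_deriv nonpos has_field_derivative_at_within in force)
  hence "AE t in lebesgue_on {0..}. (E has_real_derivative \<phi> t) (at t within {0..}) \<and> \<phi> t \<le> 0"
    by (subst AE_restrict_space_iff) auto
  thus "AE t in lebesgue_on {0..}.
      ((\<lambda>s. 1 / 2 * (W_norm g H (\<lambda>x. q x s))\<^sup>2) has_real_derivative
        g * H * BT g H U (\<lambda>x. q x t)) (at t within {0..}) \<and>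
      g * H * BT g H U (\<lambda>x. q x t) \<le> 0"
    unfolding E_def[abs_def] \<phi>_def .
qed (rule generalized_energy_has_integral[OF assms(1-3)])

end
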